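(* Let $G_1$ and $G_2$ be vertex-disjoint finite connected graphs with $n_1$ and $n_2$ vertices and distance matrices $D_1,D_2$, and suppose $D_iw_i=n_i\cdot\mathbf{1}$ for some $w_i\in\mathbb{R}^{n_i}_{\geq 0}$, $i=1,2$. Let $u\in V(G_1)$, $v\in V(G_2)$, and let $H$ be the graph obtained by adding the edge $\{u,v\}$ between $G_1$ and $G_2$ and then contracting this edge (equivalently, identifying $u$ and $v$ into a single vertex $c$), so $H$ has $n_1+n_2-1$ vertices. Then $H$ has a curvature $w$, i.e. $D_Hw=(n_1+n_2-1)\cdot\mathbf{1}$ with $D_H$ the distance matrix of $H$, such that $w(x)\geq 0$ for every vertex $x\neq c$ of $H$.
   Context: For a finite connected graph with vertices $v_1,\dots,v_m$, the distance matrix is $D_{ij}=d(v_i,v_j)$ (shortest-path distance), $\mathbf{1}$ is the all-ones vector, and a curvature is a vector $w\in\mathbb{R}^m$, viewed as a function on vertices, with $Dw=m\cdot\mathbf{1}$. *)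

theory Defs
  imports "Graph_Theory.Graph_Theory"
begin

text \<open>
  Finite simple graphs are \<^locale>\<open>pair_graph\<close>s: an undirected edge \<open>{x, y}\<close> is the pair of arcs
  \<open>(x, y)\<close>, \<open>(y, x)\<close>.  Vectors and matrices are indexed by the vertices themselves; only
  their values on the vertex set matter.
\<close>

text \<open>
  \<open>\<mu>\<close> is the infimum of the costs of all walks, here with unit arc costs.  It lives in \<^typ>\<open>ereal\<close>;
  the conversion to \<^typ>\<open>real\<close> loses nothing for vertices of a connected graph.
\<close>
definition distance_matrix :: "'a pair_pre_digraph \<Rightarrow> 'a \<Rightarrow> 'a \<Rightarrow> real" where
  "distance_matrix G x y = real_of_ereal (wf_digraph.\<mu> (with_proj G) (\<lambda>_. 1) x y)"

definition is_curvature :: "'a pair_pre_digraph \<Rightarrow> ('a \<Rightarrow> real) \<Rightarrow> bool" where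
  "is_curvature G w \<longleftrightarrow>
    (\<forall>x\<in>pverts G. (\<Sum>y\<in>pverts G. distance_matrix G x y * w y) = real (card (pverts G)))"

definition graph_union :: "'a pair_pre_digraph \<Rightarrow> 'a pair_pre_digraph \<Rightarrow> 'a pair_pre_digraph" where
  "graph_union G H = \<lparr> pverts = pverts G \<union> pverts H, parcs = parcs G \<union> parcs H \<rparr>"

definition add_edge :: "'a pair_pre_digraph \<Rightarrow> 'a \<Rightarrow> 'a \<Rightarrow> 'a pair_pre_digraph" where
  "add_edge G u v = \<lparr> pverts = pverts G, parcs = parcs G \<union> {(u, v), (v, u)} \<rparr>"

text \<open>
  Contraction of the edge \<open>{u, v}\<close> into a vertex \<open>c\<close>, dropping loops.  The name \<open>c\<close> may be \<open>u\<close>, \<open>v\<close>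
  or fresh, but must not be another vertex of the graph.
\<close>
definition contract_edge :: "'a pair_pre_digraph \<Rightarrow> 'a \<Rightarrow> 'a \<Rightarrow> 'a \<Rightarrow> 'a pair_pre_digraph" where
  "contract_edge G u v c =
    (let f = (\<lambda>x. if x = u \<or> x = v then c else x) in
     \<lparr> pverts = f ` pverts G,
       parcs = {(f x, f y) | x y. (x, y) \<in> parcs G \<and> f x \<noteq> f y} \<rparr>)"

lemma distance_matrix_eq_Least:
  assumes "pair_graph G" and "Digraph_Component.connected (with_proj G)"
    and "x \<in> pverts G" and "y \<in> pverts G"
  shows "distance_matrix G x y
    = real (LEAST n. \<exists>p. pre_digraph.awalk (with_proj G) x p y \<and> length p = n)"
proof -
  interpret pair_graph G by fact
  have "strongly_connected (with_proj G)"
    using symmetric_connected_imp_strongly_connected assms(2) sym_arcs by blast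
  then have "x \<rightarrow>\<^sup>*\<^bsub>with_proj G\<^esub> y"
    using assms(3,4) by auto
  then obtain p0 where p0: "awalk x p0 y"
    by (auto simp: reachable_awalk)
  let ?P = "\<lambda>n. \<exists>p. awalk x p y \<and> length p = n"
  have cost: "awalk_cost (\<lambda>_. 1) p = real (length p)" for p :: "('a \<times> 'a) list"
    by (induction p) auto
  have "?P (LEAST n. ?P n)"
    by (rule LeastI[of ?P "length p0"]) (use p0 in auto)
  then obtain p where p: "awalk x p y" "length p = (LEAST n. ?P n)" by blast
  have "\<mu> (\<lambda>_. 1) x y = ereal (real (LEAST n. ?P n))"
    unfolding \<mu>_def cost
  proof (rule antisym)
    show "(INF q\<in>{q. awalk x q y}. ereal (real (length q))) \<le> ereal (real (LEAST n. ?P n))"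
      using p by (intro INF_lower2[of p]) auto
    show "ereal (real (LEAST n. ?P n)) \<le> (INF q\<in>{q. awalk x q y}. ereal (real (length q)))"
    proof (rule INF_greatest)
      fix q assume "q \<in> {q. awalk x q y}"
      then have "(LEAST n. ?P n) \<le> length q" by (intro Least_le) auto
      then show "ereal (real (LEAST n. ?P n)) \<le> ereal (real (length q))" by simp
    qed
  qed
  then show ?thesis by (simp add: distance_matrix_def)
qed

lemma pair_graph_graph_union:
  assumes "pair_graph G" and "pair_graph H"
  shows "pair_graph (graph_union G H)"
proof -
  interpret G: pair_graph G by fact
  interpret H: pair_graph H by fact
  show ?thesis
    by unfold_locales
      (auto simp: graph_union_def symmetric_def sym_def
        dest: G.arcs_symmetric H.arcs_symmetric G.no_loops' H.no_loops'
          G.wellformed' H.wellformed'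
        intro: G.pair_finite_verts H.pair_finite_verts G.pair_finite_arcs H.pair_finite_arcs)
qed

lemma pair_graph_add_edge:
  assumes "pair_graph G" and "u \<in> pverts G" and "v \<in> pverts G" and "u \<noteq> v"
  shows "pair_graph (add_edge G u v)"
proof -
  interpret G: pair_graph G by fact
  show ?thesis
    using assms(2-)
    by unfold_locales
      (auto simp: add_edge_def symmetric_def sym_def
        dest: G.arcs_symmetric G.no_loops' G.wellformed'
        intro: G.pair_finite_verts G.pair_finite_arcs)
qed

lemma pair_graph_contract_edge:
  assumes "pair_graph G"
  shows "pair_graph (contract_edge G u v c)"
proof -
  interpret G: pair_graph G by fact
  define f where "f = (\<lambda>x. if x = u \<or> x = v then c else x)"
  have eq: "contract_edge G u v c =
      \<lparr> pverts = f ` pverts G, parcs = {(f x, f y) | x y. (x, y) \<in> parcs G \<and> f x \<noteq> f y} \<rparr>"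
    by (simp add: contract_edge_def f_def Let_def)
  have "{(f x, f y) | x y. (x, y) \<in> parcs G \<and> f x \<noteq> f y} \<subseteq> (\<lambda>(x, y). (f x, f y)) ` parcs G"
    by auto
  then have "finite {(f x, f y) | x y. (x, y) \<in> parcs G \<and> f x \<noteq> f y}"
    using G.pair_finite_arcs finite_surj by blast
  then show ?thesis
    unfolding eq
    apply unfold_locales
    apply (auto simp: symmetric_def sym_def
        dest: G.wellformed' intro: G.pair_finite_verts)
    by (metis G.arcs_symmetric)
qed

end

theory Submission
  imports Defs
begin

text \<open>
  In the glued graph \<open>H\<close>, distances between vertices of the same \<open>G\<^sub>i\<close> are unchanged, and the
  distance from \<open>x\<close> in \<open>G\<^sub>1\<close> to \<open>y\<close> in \<open>G\<^sub>2\<close> is \<open>d\<^sub>1(x, u) + d\<^sub>2(v, y)\<close>.  Let \<open>W\<^sub>i > 0\<close> be the total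
  weight of \<open>w\<^sub>i\<close>.  For \<open>w = \<alpha> w\<^sub>1 + \<beta> w\<^sub>2 - \<gamma> \<delta>\<^sub>c\<close>, row \<open>x\<close> of \<open>D\<^sub>H w\<close> with \<open>x\<close> in \<open>G\<^sub>1\<close> is
  \<open>\<alpha> n\<^sub>1 + \<beta> n\<^sub>2 + d\<^sub>1(x, u) (\<beta> W\<^sub>2 - \<gamma>)\<close>, and symmetrically for \<open>G\<^sub>2\<close>.  So \<open>D\<^sub>H w\<close> is constant for
  \<open>\<alpha> = t W\<^sub>2\<close>, \<open>\<beta> = t W\<^sub>1\<close>, \<open>\<gamma> = t W\<^sub>1 W\<^sub>2\<close>; the scale \<open>t > 0\<close> is then determined by the required
  constant, and \<open>w\<close> can only be negative at \<open>c\<close>.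
\<close>

section \<open>Lengths and images of walks\<close>

text \<open>A function growing by at most 1 along each arc certifies a lower bound on walk lengths.
  This replaces cutting walks of the glued graph at the merged vertex.\<close>

lemma awalk_length_ge_potential:
  fixes g :: "'a \<Rightarrow> real"
  assumes "pair_graph G"
    and step: "\<And>a b. (a, b) \<in> parcs G \<Longrightarrow> g b \<le> g a + 1"
    and "pre_digraph.awalk (with_proj G) x p y"
  shows "g y \<le> g x + real (length p)"
proof -
  interpret pair_graph G by fact
  from assms(3) show ?thesis
  proof (induction p arbitrary: x)
    case Nil
    then show ?case by (simp add: awalk_Nil_iff)
  next
    case (Cons e p)
    obtain a b where e: "e = (a, b)" by (cases e)
    from Cons.prems have "a = x" "(x, b) \<in> parcs G" "awalk b p y"
      by (auto simp: awalk_Cons_iff e)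
    then show ?case using Cons.IH[of b] step[of x b] by simp
  qed
qed

lemma awalk_map:
  assumes "pair_graph G" and "pair_graph H"
    and verts: "\<And>a. a \<in> pverts G \<Longrightarrow> f a \<in> pverts H"
    and arcs: "\<And>a b. (a, b) \<in> parcs G \<Longrightarrow> (f a, f b) \<in> parcs H"
    and "pre_digraph.awalk (with_proj G) x p y"
  shows "pre_digraph.awalk (with_proj H) (f x) (map (map_prod f f) p) (f y)"
proof -
  interpret G: pair_graph G by fact
  interpret H: pair_graph H by fact
  from assms(5) show ?thesis
  proof (induction p arbitrary: x)
    case Nil
    then show ?case using verts by (auto simp: G.awalk_Nil_iff H.awalk_Nil_iff)
  next
    case (Cons e p)
    obtain a b where e: "e = (a, b)" by (cases e)
    from Cons.prems have "a = x" "(x, b) \<in> parcs G" "G.awalk b p y"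
      by (auto simp: G.awalk_Cons_iff e)
    then show ?case using Cons.IH[of b] arcs[of x b] by (simp add: H.awalk_Cons_iff e)
  qed
qed

section \<open>Distances in a connected graph\<close>

locale connected_pair_graph = pair_graph G for G :: "'a pair_pre_digraph" (structure) +
  assumes connected: "Digraph_Component.connected (with_proj G)"
begin

lemma obtain_awalk:
  assumes "x \<in> pverts G" and "y \<in> pverts G"
  obtains p where "awalk x p y"
proof -
  have "strongly_connected (with_proj G)"
    using symmetric_connected_imp_strongly_connected connected sym_arcs by blast
  then have "x \<rightarrow>\<^sup>*\<^bsub>with_proj G\<^esub> y"
    using assms by auto
  then show thesis using that by (auto simp: reachable_awalk)
qed

lemma obtain_shortest_awalk:
  assumes "x \<in> pverts G" and "y \<in> pverts G"
  obtains p where "awalk x p y" and "distance_matrix G x y = real (length p)"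
proof -
  obtain p0 where "awalk x p0 y" using obtain_awalk assms by blast
  then have "\<exists>p. awalk x p y \<and> length p = length p0" by blast
  then have "\<exists>p. awalk x p y \<and> length p = (LEAST n. \<exists>p. awalk x p y \<and> length p = n)"
    by (rule LeastI[where P = "\<lambda>n. \<exists>p. awalk x p y \<and> length p = n"])
  then show thesis
    using that distance_matrix_eq_Least[OF pair_graph_axioms connected assms] by auto
qed

lemma distance_le_length:
  assumes "awalk x p y"
  shows "distance_matrix G x y \<le> real (length p)"
proof -
  have "x \<in> pverts G" "y \<in> pverts G" using assms by auto
  then show ?thesis
    using assms by (subst distance_matrix_eq_Least[OF pair_graph_axioms connected])
      (auto intro!: Least_le)
qed

lemma distance_nonneg:
  assumes "x \<in> pverts G" and "y \<in> pverts G"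
  shows "0 \<le> distance_matrix G x y"
  using obtain_shortest_awalk[OF assms] by (metis of_nat_0_le_iff)

lemma distance_self: "x \<in> pverts G \<Longrightarrow> distance_matrix G x x = 0"
  using distance_le_length[of x "[]" x] distance_nonneg[of x x] by (simp add: awalk_Nil_iff)

lemma distance_triangle:
  assumes "x \<in> pverts G" and "y \<in> pverts G" and "z \<in> pverts G"
  shows "distance_matrix G x z \<le> distance_matrix G x y + distance_matrix G y z"
proof -
  obtain p where p: "awalk x p y" "distance_matrix G x y = real (length p)"
    using obtain_shortest_awalk assms by blast
  obtain q where q: "awalk y q z" "distance_matrix G y z = real (length q)"
    using obtain_shortest_awalk assms by blast
  have "awalk x (p @ q) z" using p q by auto
  from distance_le_length[OF this] show ?thesis using p q by simp
qed

text \<open>Supplies the growth condition for the function built in \<open>potential\<close>, which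
  is pieced together from distances.\<close>

lemma distance_arc:
  assumes "x \<in> pverts G" and "(a, b) \<in> parcs G"
  shows "distance_matrix G x b \<le> distance_matrix G x a + 1"
proof -
  have ab: "a \<in> pverts G" "b \<in> pverts G" using assms(2) by (auto dest: wellformed')
  have "awalk a [(a, b)] b"
    using assms(2) ab by (simp add: awalk_Cons_iff awalk_Nil_iff)
  from distance_le_length[OF this] distance_triangle[OF assms(1) ab] show ?thesis by simp
qed

lemma distance_ge_potential:
  fixes g :: "'a \<Rightarrow> real"
  assumes "\<And>a b. (a, b) \<in> parcs G \<Longrightarrow> g b \<le> g a + 1"
    and "x \<in> pverts G" and "y \<in> pverts G"
  shows "g y - g x \<le> distance_matrix G x y"
proof -
  obtain p where p: "awalk x p y" "distance_matrix G x y = real (length p)"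
    using obtain_shortest_awalk assms(2,3) by blast
  then show ?thesis
    using awalk_length_ge_potential[where g = g, OF pair_graph_axioms assms(1) p(1)] by simp
qed

lemma distance_map_le:
  assumes "connected_pair_graph H"
    and "\<And>a. a \<in> pverts G \<Longrightarrow> f a \<in> pverts H"
    and "\<And>a b. (a, b) \<in> parcs G \<Longrightarrow> (f a, f b) \<in> parcs H"
    and "x \<in> pverts G" and "y \<in> pverts G"
  shows "distance_matrix H (f x) (f y) \<le> distance_matrix G x y"
proof -
  interpret H: connected_pair_graph H by fact
  obtain p where p: "awalk x p y" "distance_matrix G x y = real (length p)"
    using obtain_shortest_awalk assms(4,5) by blast
  have "H.awalk (f x) (map (map_prod f f) p) (f y)"
    by (rule awalk_map[OF pair_graph_axioms H.pair_graph_axioms assms(2,3) p(1)])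
  from H.distance_le_length[OF this] show ?thesis using p(2) by simp
qed

text \<open>If the total were zero, nonnegativity would force the weight to vanish at every vertex,
  and each row sum would be 0 instead of the positive number of vertices.\<close>

lemma curvature_total_pos:
  assumes "is_curvature G w" and "\<And>x. x \<in> pverts G \<Longrightarrow> 0 \<le> w x" and "pverts G \<noteq> {}"
  shows "0 < sum w (pverts G)"
proof (rule ccontr)
  assume "\<not> 0 < sum w (pverts G)"
  with sum_nonneg[of "pverts G" w] assms(2) have "sum w (pverts G) = 0" by fastforce
  then have "\<forall>x\<in>pverts G. w x = 0" using assms(2) by (simp add: sum_nonneg_eq_0_iff)
  moreover obtain x where "x \<in> pverts G" using assms(3) by blast
  ultimately show False using assms(1,3) by (auto simp: is_curvature_def)
qed

end

section \<open>Gluing two graphs at a vertex\<close>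

text \<open>The gluing is described by a map \<open>f\<close>, injective on each side, instead of by
  contraction: the two graphs then play symmetric roles and the name of the merged vertex does not
  enter.\<close>

locale vertex_gluing =
  G1: connected_pair_graph G1 + G2: connected_pair_graph G2 + H: pair_graph H
  for G1 G2 :: "'a pair_pre_digraph" and H :: "'b pair_pre_digraph" +
  fixes u v :: 'a and f :: "'a \<Rightarrow> 'b"
  assumes u: "u \<in> pverts G1" and v: "v \<in> pverts G2" and glue: "f u = f v"
    and inj1: "inj_on f (pverts G1)" and inj2: "inj_on f (pverts G2)"
    and overlap: "\<And>x y. x \<in> pverts G1 \<Longrightarrow> y \<in> pverts G2 \<Longrightarrow> f x = f y \<Longrightarrow> x = u \<and> y = v"
    and verts: "pverts H = f ` pverts G1 \<union> f ` pverts G2"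
    and arcs: "parcs H = map_prod f f ` (parcs G1 \<union> parcs G2)"
begin

text \<open>Lets results about \<open>G1\<close> be reused for \<open>G2\<close> through the
  interpretation \<open>swap\<close>.\<close>

lemma gluing_commute: "vertex_gluing G2 G1 H v u f"
proof unfold_locales
  show "pverts H = f ` pverts G2 \<union> f ` pverts G1" using verts by blast
  show "parcs H = map_prod f f ` (parcs G2 \<union> parcs G1)" by (simp add: arcs Un_commute)
  show "y = v \<and> x = u" if "y \<in> pverts G2" "x \<in> pverts G1" "f y = f x" for x y
    using overlap[of x y] that by simp
qed (fact u v inj1 inj2 glue[symmetric])+

lemma map_vert: "x \<in> pverts G1 \<union> pverts G2 \<Longrightarrow> f x \<in> pverts H"
  by (auto simp: verts)

lemma map_arc: "(x, y) \<in> parcs G1 \<union> parcs G2 \<Longrightarrow> (f x, f y) \<in> parcs H"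
  unfolding arcs by (rule image_eqI[of _ _ "(x, y)"]) simp_all

lemma reachable_glue:
  assumes "z \<in> pverts H"
  shows "f u \<rightarrow>\<^sup>*\<^bsub>with_proj H\<^esub> z \<and> z \<rightarrow>\<^sup>*\<^bsub>with_proj H\<^esub> f u"
proof -
  have 1: "f x \<rightarrow>\<^sup>*\<^bsub>with_proj H\<^esub> f y" if xy: "x \<in> pverts G1" "y \<in> pverts G1" for x y
  proof -
    obtain p where "G1.awalk x p y" using G1.obtain_awalk[OF xy] .
    then have "H.awalk (f x) (map (map_prod f f) p) (f y)"
      by (rule awalk_map[OF G1.pair_graph_axioms H.pair_graph_axioms, rotated 2])
        (simp_all add: map_vert map_arc)
    then show ?thesis unfolding H.reachable_awalk by blast
  qed
  have 2: "f x \<rightarrow>\<^sup>*\<^bsub>with_proj H\<^esub> f y" if xy: "x \<in> pverts G2" "y \<in> pverts G2" for x y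
  proof -
    obtain p where "G2.awalk x p y" using G2.obtain_awalk[OF xy] .
    then have "H.awalk (f x) (map (map_prod f f) p) (f y)"
      by (rule awalk_map[OF G2.pair_graph_axioms H.pair_graph_axioms, rotated 2])
        (simp_all add: map_vert map_arc)
    then show ?thesis unfolding H.reachable_awalk by blast
  qed
  from assms consider x where "x \<in> pverts G1" "z = f x" | x where "x \<in> pverts G2" "z = f x"
    using verts by blast
  then show ?thesis
    using 1 u 2 v glue by cases metis+
qed

lemma connected_gluing: "connected_pair_graph H"
proof unfold_locales
  have "a \<rightarrow>\<^sup>*\<^bsub>with_proj H\<^esub> b" if "a \<in> pverts H" "b \<in> pverts H" for a b
    using that reachable_glue H.reachable_trans by blast
  moreover have "pverts H \<noteq> {}" using u by (auto simp: verts)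
  \<comment> \<open>\<open>Digraph_Component.connected\<close> refers to the symmetrised graph; as
    the arcs of \<open>H\<close> are symmetric, reachability there is the same as in
    \<open>H\<close>.\<close>
  ultimately show "Digraph_Component.connected (with_proj H)"
    by (auto simp: connected_def H.reachable_mk_symmetric_eq[OF H.sym_arcs])
qed

sublocale H: connected_pair_graph H
  by (rule connected_gluing)

section \<open>Distances and size of the glued graph\<close>

text \<open>Together with \<open>distance_ge_potential\<close>, this yields the lower bounds on distances in \<open>H\<close>.\<close>
lemma potential:
  assumes "x \<in> pverts G1"
  obtains g :: "'b \<Rightarrow> real"
  where "\<And>a b. (a, b) \<in> parcs H \<Longrightarrow> g b \<le> g a + 1"
    and "\<And>a. a \<in> pverts G1 \<Longrightarrow> g (f a) = distance_matrix G1 x a"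
    and "\<And>b. b \<in> pverts G2 \<Longrightarrow> g (f b) = distance_matrix G1 x u + distance_matrix G2 v b"
proof -
  \<comment> \<open>This is the expected distance from \<open>f x\<close> in \<open>H\<close>. The
    merged vertex falls under the first case, so the formula for \<open>G2\<close> needs a check
    there: it holds since \<open>v\<close> has distance 0 to itself.\<close>
  define g where "g z = (if z \<in> f ` pverts G1 then distance_matrix G1 x (inv_into (pverts G1) f z)
      else distance_matrix G1 x u + distance_matrix G2 v (inv_into (pverts G2) f z))" for z
  have g1: "g (f a) = distance_matrix G1 x a" if "a \<in> pverts G1" for a
    using that inj1 by (simp add: g_def)
  have g2: "g (f b) = distance_matrix G1 x u + distance_matrix G2 v b" if b: "b \<in> pverts G2" for b
  proof (cases "f b \<in> f ` pverts G1")
    case True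
    then have "b = v" using overlap b by fastforce
    then show ?thesis using g1[OF u] glue G2.distance_self[OF v] by simp
  next
    case False
    then show ?thesis using b inj2 by (simp add: g_def)
  qed
  have "g b \<le> g a + 1" if "(a, b) \<in> parcs H" for a b
  proof -
    obtain a' b' where ab: "a = f a'" "b = f b'" and "(a', b') \<in> parcs G1 \<or> (a', b') \<in> parcs G2"
      using \<open>(a, b) \<in> parcs H\<close> arcs by auto
    then show ?thesis
    proof (elim disjE)
      assume h: "(a', b') \<in> parcs G1"
      show ?thesis
        using G1.distance_arc[OF assms h] g1 G1.wellformed'[OF h] by (simp add: ab)
    next
      assume h: "(a', b') \<in> parcs G2"
      show ?thesis
        using G2.distance_arc[OF v h] g2 G2.wellformed'[OF h] by (simp add: ab)
    qed
  qed
  then show thesis using that g1 g2 by blast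
qed

text \<open>Walks of \<open>G1\<close> map to walks of \<open>H\<close>, so distances cannot grow;
  the potential shows that detours through \<open>G2\<close> gain nothing.\<close>

lemma distance_left:
  assumes "x \<in> pverts G1" and "y \<in> pverts G1"
  shows "distance_matrix H (f x) (f y) = distance_matrix G1 x y"
proof (rule antisym)
  show "distance_matrix H (f x) (f y) \<le> distance_matrix G1 x y"
    using assms map_vert map_arc by (intro G1.distance_map_le[OF connected_gluing]) auto
  obtain g where g: "\<And>a b. (a, b) \<in> parcs H \<Longrightarrow> g b \<le> g a + 1"
    "\<And>a. a \<in> pverts G1 \<Longrightarrow> g (f a) = distance_matrix G1 x a"
    using potential[OF assms(1)] by metis
  show "distance_matrix G1 x y \<le> distance_matrix H (f x) (f y)"
    using H.distance_ge_potential[of g "f x" "f y"] g assms map_vert G1.distance_self by auto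
qed

text \<open>The upper bound is the triangle inequality at the merged vertex, the lower bound comes
  from the potential.\<close>

lemma distance_across:
  assumes "x \<in> pverts G1" and "y \<in> pverts G2"
  shows "distance_matrix H (f x) (f y) = distance_matrix G1 x u + distance_matrix G2 v y"
proof (rule antisym)
  interpret swap: vertex_gluing G2 G1 H v u f by (rule gluing_commute)
  have "distance_matrix H (f x) (f y)
      \<le> distance_matrix H (f x) (f u) + distance_matrix H (f v) (f y)"
    using H.distance_triangle[of "f x" "f u" "f y"] map_vert assms u by (simp flip: glue)
  then show "distance_matrix H (f x) (f y) \<le> distance_matrix G1 x u + distance_matrix G2 v y"
    using assms u v by (simp add: distance_left swap.distance_left)
  obtain g where g: "\<And>a b. (a, b) \<in> parcs H \<Longrightarrow> g b \<le> g a + 1"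
    "\<And>a. a \<in> pverts G1 \<Longrightarrow> g (f a) = distance_matrix G1 x a"
    "\<And>b. b \<in> pverts G2 \<Longrightarrow> g (f b) = distance_matrix G1 x u + distance_matrix G2 v b"
    using potential[OF assms(1)] by metis
  show "distance_matrix G1 x u + distance_matrix G2 v y \<le> distance_matrix H (f x) (f y)"
    using H.distance_ge_potential[of g "f x" "f y"] g assms map_vert G1.distance_self by auto
qed

lemma card_gluing: "card (pverts H) = card (pverts G1) + card (pverts G2) - 1"
proof -
  have "f ` pverts G1 \<inter> f ` pverts G2 = {f u}"
  proof (intro equalityI subsetI)
    fix z assume "z \<in> f ` pverts G1 \<inter> f ` pverts G2"
    then obtain x y where "x \<in> pverts G1" "z = f x" "y \<in> pverts G2" "z = f y" by blast
    then show "z \<in> {f u}" using overlap[of x y] by simp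
  next
    fix z assume "z \<in> {f u}"
    then show "z \<in> f ` pverts G1 \<inter> f ` pverts G2"
      using imageI[OF u, of f] imageI[OF v, of f] glue by simp
  qed
  then show ?thesis
    using card_Un_Int[of "f ` pverts G1" "f ` pverts G2"] card_image[OF inj1] card_image[OF inj2]
    by (simp add: verts)
qed

section \<open>Weights on the glued graph and its curvature\<close>

text \<open>Push-forward of a weight along \<open>f\<close>, extended by 0; it is meant for sets
  \<open>V\<close> on which \<open>f\<close> is injective.\<close>

definition push :: "('a \<Rightarrow> real) \<Rightarrow> 'a set \<Rightarrow> 'b \<Rightarrow> real" where
  "push w V z = (if z \<in> f ` V then w (inv_into V f z) else 0)"

lemma sum_push:
  assumes "inj_on f V" and "f ` V \<subseteq> pverts H"
  shows "(\<Sum>z\<in>pverts H. h z * push w V z) = (\<Sum>x\<in>V. h (f x) * w x)"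
proof -
  have "(\<Sum>z\<in>pverts H. h z * push w V z) = (\<Sum>z\<in>f ` V. h z * push w V z)"
    using assms(2) by (intro sum.mono_neutral_right) (auto simp: push_def)
  also have "\<dots> = (\<Sum>x\<in>V. h (f x) * w x)"
    using assms(1) by (subst sum.reindex) (auto simp: push_def)
  finally show ?thesis .
qed

lemma push_nonneg: "(\<And>x. x \<in> V \<Longrightarrow> 0 \<le> w x) \<Longrightarrow> 0 \<le> push w V z"
  by (auto simp: push_def inv_into_into)

definition glued :: "('a \<Rightarrow> real) \<Rightarrow> ('a \<Rightarrow> real) \<Rightarrow> real \<Rightarrow> real \<Rightarrow> real \<Rightarrow> 'b \<Rightarrow> real" where
  "glued w1 w2 \<alpha> \<beta> \<gamma> z =
    \<alpha> * push w1 (pverts G1) z + \<beta> * push w2 (pverts G2) z - (if z = f u then \<gamma> else 0)"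

lemma sum_glued:
  "(\<Sum>z\<in>pverts H. h z * glued w1 w2 \<alpha> \<beta> \<gamma> z) =
    \<alpha> * (\<Sum>x\<in>pverts G1. h (f x) * w1 x) + \<beta> * (\<Sum>y\<in>pverts G2. h (f y) * w2 y) - h (f u) * \<gamma>"
proof -
  have "(\<Sum>z\<in>pverts H. h z * glued w1 w2 \<alpha> \<beta> \<gamma> z) =
     (\<Sum>z\<in>pverts H. \<alpha> * (h z * push w1 (pverts G1) z) + \<beta> * (h z * push w2 (pverts G2) z)
        - (if z = f u then h z * \<gamma> else 0))"
    by (intro sum.cong) (auto simp: glued_def algebra_simps)
  also have "\<dots> = \<alpha> * (\<Sum>z\<in>pverts H. h z * push w1 (pverts G1) z)
      + \<beta> * (\<Sum>z\<in>pverts H. h z * push w2 (pverts G2) z) - h (f u) * \<gamma>"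
    using map_vert u by (simp add: sum.distrib sum_subtractf sum_distrib_left)
  also have "(\<Sum>z\<in>pverts H. h z * push w1 (pverts G1) z) = (\<Sum>x\<in>pverts G1. h (f x) * w1 x)"
    using verts by (intro sum_push[OF inj1]) blast
  also have "(\<Sum>z\<in>pverts H. h z * push w2 (pverts G2) z) = (\<Sum>x\<in>pverts G2. h (f x) * w2 x)"
    using verts by (intro sum_push[OF inj2]) blast
  finally show ?thesis .
qed

text \<open>Seen from \<open>x\<close>, the weight on \<open>G2\<close> contributes an extra
  \<open>\<beta> * sum w2 (pverts G2)\<close> times the distance from \<open>x\<close> to
  \<open>u\<close>. The correction at the merged vertex cancels exactly this, so the row sum no
  longer depends on \<open>x\<close>.\<close>

lemma row_sum_left:
  assumes "is_curvature G1 w1" and "is_curvature G2 w2" and "x \<in> pverts G1"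
  shows "(\<Sum>z\<in>pverts H. distance_matrix H (f x) z * glued w1 w2 \<alpha> \<beta> (\<beta> * sum w2 (pverts G2)) z)
    = \<alpha> * real (card (pverts G1)) + \<beta> * real (card (pverts G2))"
proof -
  have "(\<Sum>y\<in>pverts G1. distance_matrix H (f x) (f y) * w1 y) = real (card (pverts G1))"
    using assms(1,3) by (simp add: is_curvature_def distance_left)
  moreover have "(\<Sum>y\<in>pverts G2. distance_matrix H (f x) (f y) * w2 y)
      = distance_matrix G1 x u * sum w2 (pverts G2) + real (card (pverts G2))"
    using assms(2,3) v
    by (simp add: is_curvature_def distance_across distrib_right sum.distrib sum_distrib_left)
  ultimately show ?thesis
    using assms(3) u by (simp add: sum_glued distance_left algebra_simps)
qed

lemma ex_curvature:
  assumes c1: "is_curvature G1 w1" and nn1: "\<And>x. x \<in> pverts G1 \<Longrightarrow> 0 \<le> w1 x"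
    and c2: "is_curvature G2 w2" and nn2: "\<And>x. x \<in> pverts G2 \<Longrightarrow> 0 \<le> w2 x"
  shows "\<exists>w. is_curvature H w \<and> (\<forall>z\<in>pverts H - {f u}. 0 \<le> w z)"
proof -
  interpret swap: vertex_gluing G2 G1 H v u f by (rule gluing_commute)
  define W1 W2 where "W1 = sum w1 (pverts G1)" and "W2 = sum w2 (pverts G2)"
  define m1 m2 where "m1 = real (card (pverts G1))" and "m2 = real (card (pverts G2))"
  \<comment> \<open>With the coefficients below every row sum is
    \<open>t * (W2 * m1 + W1 * m2)\<close>; \<open>t\<close> is solved from the required
    value.\<close>
  define t where "t = real (card (pverts H)) / (W2 * m1 + W1 * m2)"
  \<comment> \<open>Rows from \<open>G1\<close> need the correction \<open>\<beta> * W2\<close>,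
    rows from \<open>G2\<close> need \<open>\<alpha> * W1\<close>; these coefficients make the two
    agree.\<close>
  define w where "w = glued w1 w2 (t * W2) (t * W1) (t * W1 * W2)"
  have W: "0 < W1" "0 < W2"
    unfolding W1_def W2_def
    using G1.curvature_total_pos[OF c1 nn1] G2.curvature_total_pos[OF c2 nn2] u v by auto
  have m: "0 < m1" "0 < m2"
    using u v by (auto simp: m1_def m2_def card_gt_0_iff)
  have den: "0 < W2 * m1 + W1 * m2" using W m by (simp add: add_pos_pos)
  have t: "0 \<le> t" using den by (simp add: t_def)
  have "t * W2 * m1 + t * W1 * m2 = t * (W2 * m1 + W1 * m2)"
    by (simp add: algebra_simps)
  also have "\<dots> = real (card (pverts H))"
    using den by (simp add: t_def)
  finally have total: "t * W2 * m1 + t * W1 * m2 = real (card (pverts H))" .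
  \<comment> \<open>With the graphs exchanged, the correction again has the form that
    \<open>row_sum_left\<close> expects.\<close>
  have w_swap: "w = swap.glued w2 w1 (t * W1) (t * W2) (t * W2 * W1)"
    using glue by (auto simp: w_def glued_def swap.glued_def push_def swap.push_def)
  have "(\<Sum>z\<in>pverts H. distance_matrix H y z * w z) = real (card (pverts H))"
    if "y \<in> pverts H" for y
  proof -
    from that consider x where "x \<in> pverts G1" "y = f x" | x where "x \<in> pverts G2" "y = f x"
      unfolding verts by blast
    then show ?thesis
    proof cases
      case 1
      then show ?thesis
        using row_sum_left[OF c1 c2 1(1), of "t * W2" "t * W1"] total
        by (simp add: w_def W2_def m1_def m2_def)
    next
      case 2
      then show ?thesis
        using swap.row_sum_left[OF c2 c1 2(1), of "t * W1" "t * W2"] total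
        by (simp add: w_swap W1_def m1_def m2_def)
    qed
  qed
  then have "is_curvature H w" by (simp add: is_curvature_def)
  \<comment> \<open>Away from the merged vertex the correction is 0, leaving a nonnegative
    combination of nonnegative weights.\<close>
  moreover have "0 \<le> w z" if "z \<noteq> f u" for z
    using that t W push_nonneg[of "pverts G1" w1 z] push_nonneg[of "pverts G2" w2 z] nn1 nn2
    by (simp add: w_def glued_def)
  ultimately show ?thesis by blast
qed

end

section \<open>Edge contraction as a gluing\<close>

text \<open>Since \<open>c\<close> is no vertex other than \<open>u\<close> or \<open>v\<close>, the
  renaming is injective on each side and merges only \<open>u\<close> with \<open>v\<close>.\<close>

lemma vertex_gluing_contract_edge:
  assumes "connected_pair_graph G1" and "connected_pair_graph G2"
    and "pverts G1 \<inter> pverts G2 = {}" and "u \<in> pverts G1" and "v \<in> pverts G2"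
    and "c \<notin> (pverts G1 \<union> pverts G2) - {u, v}"
  shows "vertex_gluing G1 G2 (contract_edge (add_edge (graph_union G1 G2) u v) u v c) u v
    (\<lambda>x. if x = u \<or> x = v then c else x)"
    (is "vertex_gluing _ _ ?H _ _ ?f")
proof -
  interpret G1: connected_pair_graph G1 by fact
  interpret G2: connected_pair_graph G2 by fact
  have "u \<noteq> v" using assms(3-5) by blast
  then have "pair_graph ?H"
    using assms(4,5) G1.pair_graph_axioms G2.pair_graph_axioms
    by (intro pair_graph_contract_edge pair_graph_add_edge pair_graph_graph_union)
      (auto simp: graph_union_def)
  then interpret H: pair_graph ?H .
  have inj: "inj_on ?f (pverts G1)" "inj_on ?f (pverts G2)"
    using assms(3-6) by (auto simp: inj_on_def)
  have f_arc: "?f a \<noteq> ?f b" if "(a, b) \<in> parcs G1 \<union> parcs G2" for a b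
    using that
  proof
    assume h: "(a, b) \<in> parcs G1"
    show ?thesis
      unfolding inj_on_eq_iff[OF inj(1) G1.wellformed'[OF h]] by (rule G1.no_loops'[OF h])
  next
    assume h: "(a, b) \<in> parcs G2"
    show ?thesis
      unfolding inj_on_eq_iff[OF inj(2) G2.wellformed'[OF h]] by (rule G2.no_loops'[OF h])
  qed
  \<comment> \<open>The added edge becomes a loop and is discarded, while no arc of \<open>A\<close>
    becomes a loop.\<close>
  have image: "{(f x, f y) | x y. (x, y) \<in> A \<union> {(u, v), (v, u)} \<and> f x \<noteq> f y} = map_prod f f ` A"
    if "f u = f v" and "\<And>a b. (a, b) \<in> A \<Longrightarrow> f a \<noteq> f b" for f :: "'a \<Rightarrow> 'a" and A
  proof -
    let ?B = "A \<union> {(u, v), (v, u)}"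
    have "{(f x, f y) | x y. (x, y) \<in> ?B \<and> f x \<noteq> f y}
        = map_prod f f ` {(x, y). (x, y) \<in> ?B \<and> f x \<noteq> f y}"
      by (auto simp: image_iff)
    also have "{(x, y). (x, y) \<in> ?B \<and> f x \<noteq> f y} = A"
      using that by auto
    finally show ?thesis .
  qed
  have "parcs ?H = {(?f x, ?f y) | x y.
      (x, y) \<in> (parcs G1 \<union> parcs G2) \<union> {(u, v), (v, u)} \<and> ?f x \<noteq> ?f y}"
    by (simp only: contract_edge_def add_edge_def graph_union_def Let_def pair_pre_digraph.simps)
  also have "\<dots> = map_prod ?f ?f ` (parcs G1 \<union> parcs G2)"
    by (rule image[OF _ f_arc]) simp_all
  finally have arcs: "parcs ?H = map_prod ?f ?f ` (parcs G1 \<union> parcs G2)" .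
  show ?thesis
  proof unfold_locales
    show "pverts ?H = ?f ` pverts G1 \<union> ?f ` pverts G2"
      by (simp add: contract_edge_def add_edge_def graph_union_def Let_def image_Un)
  next
    fix x y assume "x \<in> pverts G1" "y \<in> pverts G2" "?f x = ?f y"
    then show "x = u \<and> y = v"
      using assms(3-6) by (auto split: if_splits)
  next
    show "parcs ?H = map_prod ?f ?f ` (parcs G1 \<union> parcs G2)" by (rule arcs)
    show "inj_on ?f (pverts G1)" "inj_on ?f (pverts G2)" by (rule inj)+
    show "?f u = ?f v" by simp
  qed (rule assms)+
qed

theorem theorem3:
  fixes G1 G2 H :: "'a pair_pre_digraph"
    and n1 n2 :: nat
    and w1 w2 :: "'a \<Rightarrow> real"
    and u v c :: 'a
  assumes "pair_graph G1" and "Digraph_Component.connected (with_proj G1)"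
    and "pair_graph G2" and "Digraph_Component.connected (with_proj G2)"
    and "pverts G1 \<inter> pverts G2 = {}"
    and "n1 = card (pverts G1)" and "n2 = card (pverts G2)"
    and "is_curvature G1 w1" and "\<forall>x\<in>pverts G1. w1 x \<ge> 0"
    and "is_curvature G2 w2" and "\<forall>x\<in>pverts G2. w2 x \<ge> 0"
    and "u \<in> pverts G1" and "v \<in> pverts G2"
    and "c \<notin> (pverts G1 \<union> pverts G2) - {u, v}"
    and "H = contract_edge (add_edge (graph_union G1 G2) u v) u v c"
  shows "card (pverts H) = n1 + n2 - 1 \<and>
    (\<exists>w :: 'a \<Rightarrow> real. is_curvature H w \<and> (\<forall>x\<in>pverts H - {c}. w x \<ge> 0))"
proof -
  have "connected_pair_graph G1" "connected_pair_graph G2"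
    using assms(1-4) by (auto intro!: connected_pair_graph.intro connected_pair_graph_axioms.intro)
  then interpret vertex_gluing G1 G2 H u v "\<lambda>x. if x = u \<or> x = v then c else x"
    unfolding assms(15) by (rule vertex_gluing_contract_edge) (fact assms)+
  show ?thesis
    using card_gluing ex_curvature[of w1 w2] assms(6-11) by simp
qed

end
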